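(* Let $\bm\Xi=\{\bm\xi\in\mathbb{R}^d:H\bm\xi\le h\}$, with $H\in\mathbb{R}^{n_H\times d}$ and $h\in\mathbb{R}^{n_H}$, be a full-dimensional polytope which is bounded, let $\bm\xi_T^{(1)},\dots,\bm\xi_T^{(N)}\in\bm\Xi$, let $\epsilon>0$, and let $Q\in\mathbb{R}^{d\times d}$ be positive definite. Then the risk $\mathcal{R}_\epsilon(Q)$ satisfies $$\mathcal{R}_\epsilon(Q)\ \le\ \inf\ \ \lambda\epsilon+\frac1N\sum_{i=1}^N s^{(i)},$$ where the infimum is over $\lambda\ge0$, $\alpha\ge0$, $s^{(i)}\in\mathbb{R}$, $\mu_i,\psi_i\in\mathbb{R}^{n_H}$ with $\mu_i\ge0$ and $\psi_i\ge\mu_i$ (entrywise), $i=1,\dots,N$, subject to, for all $i\in\{1,\dots,N\}$, $$\begin{bmatrix} s^{(i)}-h^\top\psi_i+\lambda\|\bm\xi_T^{(i)}\|_2^2 & \star & \star\\ 2\lambda\bm\xi_T^{(i)}-H^\top\psi_i & 4(\lambda I-Q) & \star\\ H^\top\mu_i & 0 & 4Q\end{bmatrix}\succeq0,\qquad \begin{bmatrix}\alpha & \star\\ H^\top\mu_i & \lambda I-Q\end{bmatrix}\succeq0.$$ Moreover, the inequality holds with equality if the optimal shadow cost $\lambda^\star=\lambda^\star(Q)$ satisfies $\lambda^\star\ge\lambda_{\max}(Q)$, where $\lambda_{\max}(Q)$ is the largest eigenvalue of $Q$.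
   Context: The symbol $\star$ denotes entries determined by symmetry of the matrix. Full-dimensional means that $\bm\Xi$ contains a $d$-dimensional ball of strictly positive radius. $\mathcal{P}(\bm\Xi)$ is the set of probability distributions supported on $\bm\Xi$. $\widehat{\mathbb{P}}=\frac1N\sum_{i=1}^N\delta_{\bm\xi_T^{(i)}}$ is the empirical distribution of the samples. The type-2 Wasserstein distance is given by $W^2(\widehat{\mathbb{P}},\mathbb{Q})=\inf_{\pi}\int_{\bm\Xi^2}\|\bm\xi-\bm\xi'\|_2^2\,\pi(d\bm\xi,d\bm\xi')$, the infimum being over joint distributions $\pi$ with marginals $\widehat{\mathbb{P}}$ and $\mathbb{Q}$. The ambiguity set is $\mathbb{B}_\epsilon(\widehat{\mathbb{P}})=\{\mathbb{Q}\in\mathcal{P}(\bm\Xi): W(\widehat{\mathbb{P}},\mathbb{Q})\le\sqrt\epsilon\}$. The worst-case risk is $\mathcal{R}_\epsilon(Q)=\sup_{\mathbb{Q}\in\mathbb{B}_\epsilon(\widehat{\mathbb{P}})}\mathbb{E}_{\bm\xi_T\sim\mathbb{Q}}[\bm\xi_T^\top Q\bm\xi_T]$. The (optimal) shadow cost of robustification, i.e. the optimal Lagrange multiplier of the constraint $\mathbb{Q}\in\mathbb{B}_\epsilon(\widehat{\mathbb{P}})$, is $\lambda^\star(Q)=\lim_{\Delta\epsilon\to0^+}\frac{\mathcal{R}_{\epsilon+\Delta\epsilon}(Q)-\mathcal{R}_\epsilon(Q)}{\Delta\epsilon}$. *)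

theory Defs
  imports "HOL-Probability.Probability"
begin

definition symmetric_matrix :: "real^'n^'n \<Rightarrow> bool" where
  "symmetric_matrix A \<longleftrightarrow> transpose A = A"

definition pos_def :: "real^'n^'n \<Rightarrow> bool" where
  "pos_def A \<longleftrightarrow> symmetric_matrix A \<and> (\<forall>x. x \<noteq> 0 \<longrightarrow> 0 < x \<bullet> (A *v x))"

definition pos_semidef :: "real^'n^'n \<Rightarrow> bool" where
  "pos_semidef A \<longleftrightarrow> symmetric_matrix A \<and> (\<forall>x. 0 \<le> x \<bullet> (A *v x))"

definition eigenvalue :: "real^'n^'n \<Rightarrow> real \<Rightarrow> bool" where
  "eigenvalue A k \<longleftrightarrow> (\<exists>v. v \<noteq> 0 \<and> A *v v = k *\<^sub>R v)"

definition lambda_max :: "real^'n^'n \<Rightarrow> real" where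
  "lambda_max A = (GREATEST k. eigenvalue A k)"

definition hcat :: "real^'b^'r \<Rightarrow> real^'c^'r \<Rightarrow> real^('b + 'c)^'r" where
  "hcat A B = (\<chi> i j. case j of Inl k \<Rightarrow> A $ i $ k | Inr k \<Rightarrow> B $ i $ k)"

definition vcat :: "real^'c^'a \<Rightarrow> real^'c^'b \<Rightarrow> real^'c^('a + 'b)" where
  "vcat A B = (\<chi> i. case i of Inl k \<Rightarrow> A $ k | Inr k \<Rightarrow> B $ k)"

(* Block matrices given by their lower block triangle; the blocks above the diagonal
   are the transposes of those below it. *)

definition sym_block2 ::
  "real^'a^'a \<Rightarrow> real^'a^'b \<Rightarrow> real^'b^'b \<Rightarrow> real^('a + 'b)^('a + 'b)" where
  "sym_block2 A11 A21 A22 = vcat (hcat A11 (transpose A21)) (hcat A21 A22)"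

definition sym_block3 ::
  "real^'a^'a \<Rightarrow>
   real^'a^'b \<Rightarrow> real^'b^'b \<Rightarrow>
   real^'a^'c \<Rightarrow> real^'b^'c \<Rightarrow> real^'c^'c \<Rightarrow>
   real^('a + 'b + 'c)^('a + 'b + 'c)" where
  "sym_block3 A11 A21 A22 A31 A32 A33 =
     sym_block2 A11 (vcat A21 A31) (sym_block2 A22 A32 A33)"

(* The order on vectors is the componentwise one. *)

definition polyhedron_of :: "real^'d^'m \<Rightarrow> real^'m \<Rightarrow> (real^'d) set" where
  "polyhedron_of H h = {\<xi>. H *v \<xi> \<le> h}"

definition full_dimensional :: "(real^'d) set \<Rightarrow> bool" where
  "full_dimensional S \<longleftrightarrow> (\<exists>x r. 0 < r \<and> ball x r \<subseteq> S)"

definition probs_on :: "(real^'d) set \<Rightarrow> (real^'d) measure set" where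
  "probs_on S = {P. prob_space P \<and> sets P = sets borel \<and> emeasure P S = 1}"

(* The push-forward of the uniform distribution on the indices 1, ..., N, i.e. the sum of
   the Dirac measures at the samples, counted with multiplicity, divided by N. *)

definition empirical :: "nat \<Rightarrow> (nat \<Rightarrow> real^'d) \<Rightarrow> (real^'d) measure" where
  "empirical N \<xi> = distr (uniform_count_measure {1..N}) borel \<xi>"

definition couplings ::
  "(real^'d) measure \<Rightarrow> (real^'d) measure \<Rightarrow> ((real^'d) \<times> (real^'d)) measure set" where
  "couplings P P' = {\<pi>. prob_space \<pi> \<and> sets \<pi> = sets (borel \<Otimes>\<^sub>M borel) \<and>
     distr \<pi> borel fst = P \<and> distr \<pi> borel snd = P'}"

(* The cost is integrated over the whole space; a coupling of two distributions supported
   on S is automatically supported on the product of S with itself. *)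

definition wasserstein2_sq :: "(real^'d) measure \<Rightarrow> (real^'d) measure \<Rightarrow> ennreal" where
  "wasserstein2_sq P P' =
     (INF \<pi>\<in>couplings P P'. \<integral>\<^sup>+ z. ennreal ((norm (fst z - snd z))\<^sup>2) \<partial>\<pi>)"

definition wasserstein2 :: "(real^'d) measure \<Rightarrow> (real^'d) measure \<Rightarrow> ennreal" where
  "wasserstein2 P P' =
     (if wasserstein2_sq P P' = \<top> then \<top>
      else ennreal (sqrt (enn2real (wasserstein2_sq P P'))))"

definition ambiguity_set ::
  "(real^'d) set \<Rightarrow> (real^'d) measure \<Rightarrow> real \<Rightarrow> (real^'d) measure set" where
  "ambiguity_set S P \<epsilon> = {P' \<in> probs_on S. wasserstein2 P P' \<le> ennreal (sqrt \<epsilon>)}"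

definition worst_case_risk ::
  "(real^'d) set \<Rightarrow> (real^'d) measure \<Rightarrow> real^'d^'d \<Rightarrow> real \<Rightarrow> real" where
  "worst_case_risk S P Q \<epsilon> = (SUP P'\<in>ambiguity_set S P \<epsilon>. \<integral>x. x \<bullet> (Q *v x) \<partial>P')"

definition shadow_cost ::
  "(real^'d) set \<Rightarrow> (real^'d) measure \<Rightarrow> real^'d^'d \<Rightarrow> real \<Rightarrow> real" where
  "shadow_cost S P Q \<epsilon> =
     Lim (at_right 0)
       (\<lambda>\<delta>. (worst_case_risk S P Q (\<epsilon> + \<delta>) - worst_case_risk S P Q \<epsilon>) / \<delta>)"

definition lmi_feasible ::
  "real^'d^'m \<Rightarrow> real^'m \<Rightarrow> real^'d^'d \<Rightarrow> nat \<Rightarrow> (nat \<Rightarrow> real^'d) \<Rightarrow>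
   real \<Rightarrow> real \<Rightarrow> (nat \<Rightarrow> real) \<Rightarrow> (nat \<Rightarrow> real^'m) \<Rightarrow> (nat \<Rightarrow> real^'m) \<Rightarrow> bool" where
  "lmi_feasible H h Q N \<xi> lam \<alpha> s \<mu> \<psi> \<longleftrightarrow>
     0 \<le> lam \<and> 0 \<le> \<alpha> \<and>
     (\<forall>i\<in>{1..N}.
        0 \<le> \<mu> i \<and> \<mu> i \<le> \<psi> i \<and>
        pos_semidef
          (sym_block3
             (mat (s i - h \<bullet> \<psi> i + lam * (norm (\<xi> i))\<^sup>2) :: real^1^1)
             (columnvector ((2 * lam) *\<^sub>R \<xi> i - transpose H *v \<psi> i))
               (4 *\<^sub>R (mat lam - Q))
             (columnvector (transpose H *v \<mu> i))
               (0 :: real^'d^'d)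
               (4 *\<^sub>R Q)) \<and>
        pos_semidef
          (sym_block2
             (mat \<alpha> :: real^1^1)
             (columnvector (transpose H *v \<mu> i))
               (mat lam - Q)))"

definition lmi_value ::
  "real^'d^'m \<Rightarrow> real^'m \<Rightarrow> real^'d^'d \<Rightarrow> nat \<Rightarrow> (nat \<Rightarrow> real^'d) \<Rightarrow> real \<Rightarrow> real" where
  "lmi_value H h Q N \<xi> \<epsilon> =
     Inf {lam * \<epsilon> + (1 / real N) * (\<Sum>i=1..N. s i) | lam \<alpha> s \<mu> \<psi>.
            lmi_feasible H h Q N \<xi> lam \<alpha> s \<mu> \<psi>}"

end

(* The blocks involving mu only restrict the program and can be taken to be zero. For fixed lambda the
   remaining matrix inequality says that s_i dominates the Lagrangian dual of the quadratic program
   max {x^T Q x - lambda |x - xi_i|^2 : H x <= h}; this gives the upper bound by weak duality, and for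
   lambda >= lambda_max(Q) the dual is exact, since the program is then concave with linear constraints
   and the Karush-Kuhn-Tucker conditions hold at every maximizer.

   For the equality no general duality theorem for the Wasserstein ball is needed. The risk R is concave
   in epsilon, so its right derivative lambda* is a supergradient: R(e) <= R(epsilon) + lambda* (e - epsilon)
   for all e >= 0. Moving each sample to a maximizer for lambda = lambda*, at total cost e, produces a
   distribution whose expectation is at most R(e), and this inequality turns into
   lambda* epsilon + mean of the maxima <= R(epsilon). *)

theory Submission
  imports Defs
begin

subsection \<open>Block matrices\<close>

definition vjoin :: "real^'a \<Rightarrow> real^'b \<Rightarrow> real^('a + 'b)" where
  "vjoin x y = (\<chi> i. case i of Inl k \<Rightarrow> x $ k | Inr k \<Rightarrow> y $ k)"

lemma sum_UNIV_Plus: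
  fixes f :: "'a::finite + 'b::finite \<Rightarrow> real"
  shows "sum f UNIV = (\<Sum>i\<in>UNIV. f (Inl i)) + (\<Sum>j\<in>UNIV. f (Inr j))"
  by (simp add: UNIV_Plus_UNIV[symmetric] sum.Plus del: UNIV_Plus_UNIV)

lemma vjoin_surj: "\<exists>x y. z = vjoin x y"
  by (rule exI[of _ "\<chi> i. z $ Inl i"], rule exI[of _ "\<chi> i. z $ Inr i"])
     (auto simp: vjoin_def vec_eq_iff split: sum.split)

lemma inner_vjoin: "vjoin a b \<bullet> vjoin c d = a \<bullet> c + b \<bullet> d"
  by (simp add: vjoin_def inner_vec_def sum_UNIV_Plus)

lemma vcat_mult: "vcat A B *v x = vjoin (A *v x) (B *v x)"
  by (auto simp: vcat_def vjoin_def matrix_vector_mult_def vec_eq_iff split: sum.split)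

lemma hcat_mult: "hcat A B *v vjoin x y = A *v x + B *v y"
  by (simp add: hcat_def vjoin_def matrix_vector_mult_def vec_eq_iff sum_UNIV_Plus)

lemma inner_transpose_mult:
  fixes B :: "real^'a^'b"
  shows "x \<bullet> (transpose B *v y) = y \<bullet> (B *v x)"
  by (simp add: dot_lmul_matrix inner_commute[of x])

text \<open>The two off-diagonal blocks are transposes of each other and contribute equally, whence
  the factor 2.\<close>

lemma sym_block2_quadratic:
  "vjoin x y \<bullet> (sym_block2 A B C *v vjoin x y) = x \<bullet> (A *v x) + 2 * (y \<bullet> (B *v x)) + y \<bullet> (C *v y)"
  unfolding sym_block2_def vcat_mult hcat_mult inner_vjoin inner_add_right inner_transpose_mult by simp

lemma symmetric_sym_block2:
  "symmetric_matrix (sym_block2 A B C) \<longleftrightarrow> symmetric_matrix A \<and> symmetric_matrix C"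
  unfolding symmetric_matrix_def sym_block2_def vcat_def hcat_def transpose_def vec_eq_iff
  by (auto simp: split_sum_all)

lemma pos_semidef_sym_block2:
  "pos_semidef (sym_block2 A B C) \<longleftrightarrow> symmetric_matrix A \<and> symmetric_matrix C \<and>
     (\<forall>x y. 0 \<le> x \<bullet> (A *v x) + 2 * (y \<bullet> (B *v x)) + y \<bullet> (C *v y))"
  unfolding pos_semidef_def symmetric_sym_block2 sym_block2_quadratic[symmetric]
  by (metis vjoin_surj)

lemma columnvector_mult: "columnvector b *v (t :: real^1) = (t $ 1) *\<^sub>R (b :: real^'n)"
  by (simp add: columnvector_def matrix_vector_mult_def vec_eq_iff)

lemma mat_mult: "mat a *v x = a *\<^sub>R (x :: real^'n)"
  by (simp add: mat_def matrix_vector_mult_def vec_eq_iff if_distrib[of "\<lambda>z. z * _"] cong: if_cong)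

lemma symmetric_matrix_mat: "symmetric_matrix (mat a)"
  by (simp add: symmetric_matrix_def)

lemma inner_real1: "(x :: real^1) \<bullet> y = x $ 1 * y $ 1"
  by (simp add: inner_vec_def)

text \<open>Lets the scalar corner of a bordered matrix be tested with a real number instead of a
  one-dimensional vector.\<close>

lemma all_real1: "(\<forall>t :: real^1. P (t $ 1)) \<longleftrightarrow> (\<forall>t. P t)"
  by (metis vec_component)

lemma pos_semidef_bordered2:
  "pos_semidef (sym_block2 (mat a :: real^1^1) (columnvector b) A) \<longleftrightarrow> symmetric_matrix A \<and>
     (\<forall>t x. 0 \<le> a * t\<^sup>2 + 2 * t * (b \<bullet> x) + x \<bullet> (A *v x))"
  unfolding pos_semidef_sym_block2 columnvector_mult mat_mult
  by (subst all_real1[symmetric])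
     (simp add: symmetric_matrix_mat inner_real1 power2_eq_square inner_commute mult_ac)

text \<open>The nesting in \<open>sym_block3\<close> lets the two-block expansion apply twice; the
  zero block removes the cross term between \<open>x\<close> and \<open>y\<close>.\<close>

lemma pos_semidef_bordered3:
  fixes b :: "real^'b" and c :: "real^'c"
  shows "pos_semidef (sym_block3 (mat a :: real^1^1) (columnvector b) A (columnvector c) 0 C) \<longleftrightarrow>
     symmetric_matrix A \<and> symmetric_matrix C \<and>
     (\<forall>t x y. 0 \<le> a * t\<^sup>2 + 2 * t * (b \<bullet> x) + 2 * t * (c \<bullet> y) + x \<bullet> (A *v x) + y \<bullet> (C *v y))"
proof -
  have split: "(\<forall>z. P z) \<longleftrightarrow> (\<forall>x y. P (vjoin x y))" for P :: "real^('b + 'c) \<Rightarrow> bool"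
    by (metis vjoin_surj)
  show ?thesis
    unfolding sym_block3_def pos_semidef_sym_block2 split symmetric_sym_block2
      sym_block2_quadratic vcat_mult inner_vjoin columnvector_mult mat_mult
    by (subst all_real1[symmetric])
       (simp add: symmetric_matrix_mat inner_real1 power2_eq_square inner_commute algebra_simps)
qed

subsection \<open>The penalized quadratic program on a polyhedron\<close>

lemma polyhedron_of_iff: "x \<in> polyhedron_of H h \<longleftrightarrow> (\<forall>j. (H *v x) $ j \<le> h $ j)"
  by (simp add: polyhedron_of_def less_eq_vec_def)

lemma closed_polyhedron_of: "closed (polyhedron_of H h)"
proof -
  have "polyhedron_of H h = (\<Inter>j. {x. (H *v x) $ j \<le> h $ j})"
    by (auto simp: polyhedron_of_iff)
  then show ?thesis
    by (auto intro!: closed_Collect_le continuous_intros matrix_vector_mult_linear_continuous_on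
        simp: linear_continuous_on)
qed

text \<open>The Lagrangian of the transport problem at one sample: the objective at \<open>x\<close>
  minus the price \<open>l\<close> per unit of squared distance from \<open>a\<close>.\<close>

definition penalized :: "real^'d^'d \<Rightarrow> real \<Rightarrow> real^'d \<Rightarrow> real^'d \<Rightarrow> real" where
  "penalized Q l a x = x \<bullet> (Q *v x) - l * (norm (a - x))\<^sup>2"

lemma symmetric_matrix_inner: "symmetric_matrix A \<Longrightarrow> x \<bullet> (A *v y) = y \<bullet> (A *v x)"
  by (metis inner_transpose_mult symmetric_matrix_def)

lemma symmetric_matrix_mat_diff: "symmetric_matrix (mat l - Q) \<longleftrightarrow> symmetric_matrix Q"
  by (auto simp: symmetric_matrix_def transpose_def mat_def vec_eq_iff; metis)

lemma symmetric_matrix_scaleR: "symmetric_matrix Q \<Longrightarrow> symmetric_matrix (k *\<^sub>R Q)"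
  by (simp add: symmetric_matrix_def transpose_scalar)

text \<open>The Taylor expansion at \<open>x\<close>, exact because the function is quadratic: the
  linear term carries the gradient, and the Hessian is \<open>-2 (l I - Q)\<close>.\<close>

lemma penalized_expand:
  assumes "symmetric_matrix Q"
  shows "penalized Q l a (x + d) =
    penalized Q l a x + (2 *\<^sub>R (Q *v x) - (2 * l) *\<^sub>R (x - a)) \<bullet> d - d \<bullet> ((mat l - Q) *v d)"
  using symmetric_matrix_inner[OF assms, of x d] unfolding penalized_def power2_norm_eq_inner
  by (simp add: matrix_vector_mult_diff_rdistrib mat_mult matrix_vector_right_distrib
      inner_diff_left inner_diff_right inner_add_left inner_add_right inner_commute algebra_simps)

text \<open>Testing the matrix at \<open>(1, - x / 2, 0)\<close> gives the claim, so the block \<open>c\<close> plays no role.\<close>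
lemma penalized_le_of_pos_semidef:
  fixes H :: "real^'d^'m"
  assumes psd: "pos_semidef (sym_block3
             (mat (s - h \<bullet> \<psi> + l * (norm a)\<^sup>2) :: real^1^1)
             (columnvector ((2 * l) *\<^sub>R a - transpose H *v \<psi>))
               (4 *\<^sub>R (mat l - Q))
             (columnvector c) (0 :: real^'d^'d) (4 *\<^sub>R Q))"
    and "0 \<le> \<psi>" "x \<in> polyhedron_of H h"
  shows "penalized Q l a x \<le> s"
proof -
  \<comment> \<open>Weak duality: nonnegative multipliers are paired with the nonnegative slack of a
    feasible point.\<close>
  have "0 \<le> (h - H *v x) \<bullet> \<psi>"
    using assms(2,3) unfolding inner_vec_def polyhedron_of_iff less_eq_vec_def
    by (intro sum_nonneg) simp
  moreover
  have neg: "A *v - y = - (A *v y)" for A :: "real^'d^'d" and y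
    using matrix_vector_mult_scaleR[of A "-1" y] by simp
  have "0 \<le> s - h \<bullet> \<psi> + l * (norm a)\<^sup>2 - ((2 * l) *\<^sub>R a - transpose H *v \<psi>) \<bullet> x + x \<bullet> ((mat l - Q) *v x)"
    using psd[unfolded pos_semidef_bordered3, THEN conjunct2, THEN conjunct2, rule_format,
        of 1 "- (1/2) *\<^sub>R x" 0]
    by (simp add: scaleR_matrix_vector_assoc[symmetric] matrix_vector_mult_scaleR neg algebra_simps)
  moreover have "x \<bullet> (\<psi> v* H) = \<psi> \<bullet> (H *v x)"
    by (metis dot_lmul_matrix inner_commute)
  ultimately show ?thesis
    unfolding penalized_def power2_norm_eq_inner
    by (simp add: inner_diff_left inner_diff_right matrix_vector_mult_diff_rdistrib mat_mult
        inner_commute algebra_simps)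
qed

section \<open>Finitely generated cones and Farkas' lemma\<close>

lemma convex_cone_hull_image:
  fixes f :: "'i \<Rightarrow> 'a::real_vector"
  assumes "finite I" "c \<in> convex_cone hull (f ` I)"
  obtains u where "\<And>i. i \<in> I \<Longrightarrow> 0 \<le> (u i :: real)" "c = (\<Sum>i\<in>I. u i *\<^sub>R f i)"
proof -
  \<comment> \<open>The nonnegative combinations form a convex cone containing the generators, so
    minimality of the hull puts it inside \<open>?C\<close>.\<close>
  let ?C = "{x. \<exists>u. (\<forall>i\<in>I. 0 \<le> (u i :: real)) \<and> x = (\<Sum>i\<in>I. u i *\<^sub>R f i)}"
  have "convex_cone ?C"
    unfolding convex_cone_iff
  proof (intro conjI ballI allI impI)
    show "0 \<in> ?C" by (auto intro!: exI[of _ "\<lambda>_. 0"])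
  next
    fix x y assume "x \<in> ?C" "y \<in> ?C"
    then obtain u v where "\<forall>i\<in>I. 0 \<le> u i" "x = (\<Sum>i\<in>I. u i *\<^sub>R f i)"
      "\<forall>i\<in>I. 0 \<le> v i" "y = (\<Sum>i\<in>I. v i *\<^sub>R f i)" by blast
    then show "x + y \<in> ?C"
      by (auto intro!: exI[of _ "\<lambda>i. u i + v i"] simp: sum.distrib scaleR_add_left)
  next
    fix x and k :: real assume "x \<in> ?C" "0 \<le> k"
    then obtain u where "\<forall>i\<in>I. 0 \<le> u i" "x = (\<Sum>i\<in>I. u i *\<^sub>R f i)" by blast
    then show "k *\<^sub>R x \<in> ?C" using \<open>0 \<le> k\<close>
      by (auto intro!: exI[of _ "\<lambda>i. k * u i"] simp: scaleR_sum_right)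
  qed
  moreover have "f ` I \<subseteq> ?C"
  proof clarify
    fix i assume "i \<in> I"
    then show "\<exists>u. (\<forall>i\<in>I. 0 \<le> u i) \<and> f i = (\<Sum>i\<in>I. u i *\<^sub>R f i)"
      using assms(1)
      by (intro exI[of _ "\<lambda>j. if j = i then 1 else 0"]) (auto simp: if_distrib[of "\<lambda>r. r *\<^sub>R _"] cong: if_cong)
  qed
  ultimately have "convex_cone hull (f ` I) \<subseteq> ?C" by (rule hull_minimal[rotated])
  then show ?thesis using assms(2) that by blast
qed

text \<open>A finitely generated cone is closed. If \<open>c\<close> lay outside, the negated normal
  of a strictly separating hyperplane would satisfy the premises on all \<open>f i\<close> but have
  positive inner product with \<open>c\<close>.\<close>

lemma farkas:
  fixes f :: "'i \<Rightarrow> 'a::euclidean_space"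
  assumes "finite I" "\<And>d. (\<And>i. i \<in> I \<Longrightarrow> f i \<bullet> d \<le> 0) \<Longrightarrow> c \<bullet> d \<le> 0"
  obtains u where "\<And>i. i \<in> I \<Longrightarrow> 0 \<le> (u i :: real)" "c = (\<Sum>i\<in>I. u i *\<^sub>R f i)"
proof (cases "c \<in> convex_cone hull (f ` I)")
  case True
  then show ?thesis using convex_cone_hull_image[OF assms(1)] that by metis
next
  case False
  then obtain a b where ab: "a \<bullet> c < b" "\<And>x. x \<in> convex_cone hull (f ` I) \<Longrightarrow> b < a \<bullet> x"
    using separating_hyperplane_closed_point[of "convex_cone hull (f ` I)" c]
      closed_convex_cone_hull[of "f ` I"] convex_convex_cone_hull assms(1) by blast
  have b: "b < 0" using ab(2)[OF convex_cone_hull_contains_0] by simp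
  have "f i \<bullet> (- a) \<le> 0" if "i \<in> I" for i
  proof (rule ccontr)
    assume "\<not> ?thesis"
    then have neg: "a \<bullet> f i < 0" by (simp add: inner_commute)
    \<comment> \<open>The generator is scaled so that its inner product with \<open>a\<close> is
      exactly \<open>b\<close>, against the strict separation.\<close>
    have "(b / (a \<bullet> f i)) *\<^sub>R f i \<in> convex_cone hull (f ` I)"
      using neg b that by (intro convex_cone_hull_mul hull_inc) (auto simp: divide_nonpos_nonpos)
    from ab(2)[OF this] neg show False by simp
  qed
  from assms(2)[OF this] ab(1) b show ?thesis by (simp add: inner_commute)
qed

text \<open>Moving along a feasible direction of the active constraints would otherwise improve the
  maximum to first order.\<close>
lemma penalized_kkt:
  fixes H :: "real^'d^'m"
  assumes sym: "symmetric_matrix Q" and x: "x \<in> polyhedron_of H h"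
    and max: "\<And>y. y \<in> polyhedron_of H h \<Longrightarrow> penalized Q l a y \<le> penalized Q l a x"
  obtains \<psi> where "0 \<le> \<psi>" "h \<bullet> \<psi> = \<psi> \<bullet> (H *v x)"
    "2 *\<^sub>R (Q *v x) - (2 * l) *\<^sub>R (x - a) = transpose H *v \<psi>"
proof -
  \<comment> \<open>The gradient of the penalized objective at \<open>x\<close>.\<close>
  define c where "c = 2 *\<^sub>R (Q *v x) - (2 * l) *\<^sub>R (x - a)"
  define I where "I = {j. (H *v x) $ j = h $ j}"
  have "c \<bullet> d \<le> 0" if d: "\<And>j. j \<in> I \<Longrightarrow> row j H \<bullet> d \<le> 0" for d
  proof (rule ccontr)
    assume "\<not> ?thesis"
    then have pos: "0 < c \<bullet> d" by simp
    have "\<forall>\<^sub>F t in at_right 0. (H *v (x + t *\<^sub>R d)) $ j \<le> h $ j" for j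
    proof (cases "j \<in> I")
      case True
      have "\<forall>\<^sub>F t in at_right (0::real). 0 < t" by (simp add: eventually_at_right_less)
      then show ?thesis
      proof eventually_elim
        case (elim t)
        have "(H *v d) $ j \<le> 0" using d[OF True] by (simp add: matrix_vector_mul_component row_def)
        then have "t * (H *v d) $ j \<le> 0" using elim by (simp add: mult_nonneg_nonpos)
        then show ?case using True
          by (simp add: I_def matrix_vector_right_distrib matrix_vector_mult_scaleR)
      qed
    next
      case False
      then have lt: "(H *v x) $ j < h $ j" using x by (auto simp: I_def polyhedron_of_iff less_le)
      have "((\<lambda>t. (H *v x) $ j + t * (H *v d) $ j) \<longlongrightarrow> (H *v x) $ j + 0 * (H *v d) $ j) (at_right 0)"
        by (intro tendsto_intros)
      then have "\<forall>\<^sub>F t in at_right 0. (H *v x) $ j + t * (H *v d) $ j < h $ j"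
        using lt by (intro order_tendstoD(2)) auto
      then show ?thesis
        by eventually_elim (simp add: matrix_vector_right_distrib matrix_vector_mult_scaleR)
    qed
    then have "\<forall>\<^sub>F t in at_right 0. \<forall>j. (H *v (x + t *\<^sub>R d)) $ j \<le> h $ j"
      by (simp add: eventually_all_finite)
    \<comment> \<open>By the exact expansion the gain along \<open>d\<close> is \<open>t\<close>
      times this expression, whose limit \<open>c \<bullet> d\<close> is positive.\<close>
    moreover have "((\<lambda>t. c \<bullet> d - t * (d \<bullet> ((mat l - Q) *v d))) \<longlongrightarrow> c \<bullet> d - 0 * (d \<bullet> ((mat l - Q) *v d))) (at_right 0)"
      by (intro tendsto_intros)
    then have "\<forall>\<^sub>F t in at_right 0. 0 < c \<bullet> d - t * (d \<bullet> ((mat l - Q) *v d))"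
      using pos by (intro order_tendstoD(1)) auto
    moreover have "\<forall>\<^sub>F t in at_right (0::real). 0 < t" by (simp add: eventually_at_right_less)
    ultimately have "\<forall>\<^sub>F t::real in at_right 0. False"
    proof eventually_elim
      case (elim t)
      then have "penalized Q l a (x + t *\<^sub>R d) \<le> penalized Q l a x"
        by (intro max) (simp add: polyhedron_of_iff)
      then have "t * (c \<bullet> d - t * (d \<bullet> ((mat l - Q) *v d))) \<le> 0"
        unfolding penalized_expand[OF sym] c_def[symmetric]
        by (simp add: matrix_vector_mult_scaleR algebra_simps)
      then show ?case using elim by (simp add: mult_le_0_iff)
    qed
    then show False by simp
  qed
  then obtain u where u: "\<And>j. j \<in> I \<Longrightarrow> 0 \<le> u j" "c = (\<Sum>j\<in>I. u j *\<^sub>R row j H)"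
    using farkas[of I "\<lambda>j. row j H" c] by auto
  \<comment> \<open>Extension by zero to the inactive constraints, which is complementary
    slackness.\<close>
  define \<psi> :: "real^'m" where "\<psi> = (\<chi> j. if j \<in> I then u j else 0)"
  show thesis
  proof
    show "0 \<le> \<psi>" using u(1) by (simp add: \<psi>_def less_eq_vec_def)
    show "h \<bullet> \<psi> = \<psi> \<bullet> (H *v x)"
      unfolding inner_vec_def by (intro sum.cong) (auto simp: \<psi>_def I_def)
    have "c = (\<Sum>j\<in>UNIV. (\<psi> $ j) *\<^sub>R row j H)"
      unfolding u(2) by (intro sum.mono_neutral_cong_left) (auto simp: \<psi>_def)
    also have "\<dots> = transpose H *v \<psi>"
      by (simp add: vec_eq_iff vector_matrix_mult_def row_def mult.commute)
    finally show "2 *\<^sub>R (Q *v x) - (2 * l) *\<^sub>R (x - a) = transpose H *v \<psi>" by (simp add: c_def)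
  qed
qed

text \<open>At a maximizer \<open>x\<close> the quadratic form of the block matrix at \<open>(t, w, v)\<close> is the form of
  \<open>l I - Q\<close> at \<open>2 w + t x\<close> plus that of \<open>Q\<close> at \<open>2 v\<close>.\<close>
lemma pos_semidef_of_maximizer:
  fixes H :: "real^'d^'m"
  assumes Q: "pos_semidef Q" and lQ: "pos_semidef (mat l - Q)" and x: "x \<in> polyhedron_of H h"
    and max: "\<And>y. y \<in> polyhedron_of H h \<Longrightarrow> penalized Q l a y \<le> penalized Q l a x"
  obtains \<psi> where "0 \<le> \<psi>" "pos_semidef (sym_block3
             (mat (penalized Q l a x - h \<bullet> \<psi> + l * (norm a)\<^sup>2) :: real^1^1)
             (columnvector ((2 * l) *\<^sub>R a - transpose H *v \<psi>))
               (4 *\<^sub>R (mat l - Q))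
             (columnvector (0 :: real^'d)) (0 :: real^'d^'d) (4 *\<^sub>R Q))"
proof -
  have sQ: "symmetric_matrix Q" and sM: "symmetric_matrix (mat l - Q)"
    using Q lQ by (auto simp: pos_semidef_def)
  obtain \<psi> where \<psi>: "0 \<le> \<psi>" "h \<bullet> \<psi> = \<psi> \<bullet> (H *v x)"
    "2 *\<^sub>R (Q *v x) - (2 * l) *\<^sub>R (x - a) = transpose H *v \<psi>"
    using penalized_kkt[OF sQ x max] .
  define M where "M = mat l - Q"
  have Mx: "M *v x = l *\<^sub>R x - Q *v x"
    by (simp add: M_def matrix_vector_mult_diff_rdistrib mat_mult)
  \<comment> \<open>Stationarity turns the border into \<open>2 *\<^sub>R (M *v x)\<close>;
    complementary slackness then turns the corner into \<open>x \<bullet> (M *v x)\<close>, as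
    completing the square requires.\<close>
  have b: "(2 * l) *\<^sub>R a - transpose H *v \<psi> = 2 *\<^sub>R (M *v x)"
    unfolding \<psi>(3)[symmetric] Mx by (simp add: algebra_simps)
  have "\<psi> \<bullet> (H *v x) = x \<bullet> (transpose H *v \<psi>)"
    by (metis inner_transpose_mult)
  then have "h \<bullet> \<psi> = x \<bullet> (2 *\<^sub>R (Q *v x) - (2 * l) *\<^sub>R (x - a))"
    using \<psi>(2,3) by simp
  then have a: "penalized Q l a x - h \<bullet> \<psi> + l * (norm a)\<^sup>2 = x \<bullet> (M *v x)"
    unfolding penalized_def power2_norm_eq_inner Mx
    by (simp add: inner_diff_left inner_diff_right inner_commute algebra_simps)
  have "0 \<le> x \<bullet> (M *v x) * t\<^sup>2 + 2 * t * ((2 *\<^sub>R (M *v x)) \<bullet> w) + 2 * t * (0 \<bullet> v)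
      + w \<bullet> ((4 *\<^sub>R M) *v w) + v \<bullet> ((4 *\<^sub>R Q) *v v)" for t w v
  proof -
    have "0 \<le> (2 *\<^sub>R w + t *\<^sub>R x) \<bullet> (M *v (2 *\<^sub>R w + t *\<^sub>R x))"
      using lQ unfolding pos_semidef_def M_def by blast
    also have "\<dots> = x \<bullet> (M *v x) * t\<^sup>2 + 2 * t * ((2 *\<^sub>R (M *v x)) \<bullet> w) + w \<bullet> ((4 *\<^sub>R M) *v w)"
      using symmetric_matrix_inner[OF sM, of x w, folded M_def]
      by (simp add: matrix_vector_right_distrib matrix_vector_mult_scaleR inner_add_left
          inner_add_right scaleR_matrix_vector_assoc[symmetric] power2_eq_square
          inner_commute algebra_simps)
    finally show ?thesis
      using Q by (simp add: scaleR_matrix_vector_assoc[symmetric] pos_semidef_def)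
  qed
  then have "pos_semidef (sym_block3
             (mat (penalized Q l a x - h \<bullet> \<psi> + l * (norm a)\<^sup>2) :: real^1^1)
             (columnvector ((2 * l) *\<^sub>R a - transpose H *v \<psi>))
               (4 *\<^sub>R (mat l - Q))
             (columnvector (0 :: real^'d)) (0 :: real^'d^'d) (4 *\<^sub>R Q))"
    unfolding pos_semidef_bordered3 a b M_def[symmetric]
    using symmetric_matrix_scaleR sQ sM[folded M_def] by blast
  then show thesis using that \<psi>(1) by blast
qed

subsection \<open>The largest eigenvalue\<close>

text \<open>By compactness the quadratic form has a maximum \<open>k\<close> on the unit sphere.
  Then \<open>mat k - A\<close> is positive semidefinite and its form vanishes at the maximizer,
  which forces an eigenvector. This also shows that the \<open>GREATEST\<close> in
  \<open>lambda_max\<close> exists.\<close>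

lemma rayleigh_max:
  fixes A :: "real^'n^'n"
  assumes "symmetric_matrix A"
  shows "pos_semidef (mat (lambda_max A) - A)" "eigenvalue A (lambda_max A)"
proof -
  let ?q = "\<lambda>x. x \<bullet> (A *v x)"
  have "axis undefined 1 \<in> sphere (0::real^'n) 1" by (simp add: norm_axis_1)
  then have ne: "sphere (0::real^'n) 1 \<noteq> {}" by blast
  have "continuous_on (sphere 0 1) ?q"
    by (intro continuous_intros matrix_vector_mult_linear_continuous_on)
  then obtain v where v: "v \<in> sphere 0 1" "\<And>y. y \<in> sphere 0 1 \<Longrightarrow> ?q y \<le> ?q v"
    using continuous_attains_sup[OF compact_sphere ne] by blast
  define k where "k = ?q v"
  define M where "M = mat k - A"
  have Mx: "M *v x = k *\<^sub>R x - A *v x" for x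
    by (simp add: M_def matrix_vector_mult_diff_rdistrib mat_mult)
  have nonneg: "0 \<le> x \<bullet> (M *v x)" for x
  proof (cases "x = 0")
    case False
    have "?q ((1 / norm x) *\<^sub>R x) \<le> k" unfolding k_def by (rule v) (simp add: False)
    then show ?thesis using False
      by (simp add: Mx matrix_vector_mult_scaleR inner_diff_right field_simps
          power2_norm_eq_inner[symmetric] power2_eq_square)
  qed simp
  have sM: "symmetric_matrix M" using assms by (simp add: M_def symmetric_matrix_mat_diff)
  have v1: "v \<bullet> v = 1" using v(1) by (simp add: norm_eq_1)
  have zero: "v \<bullet> (M *v v) = 0" by (simp add: Mx inner_diff_right v1 k_def)
  have Mv: "M *v v = 0"
  proof (rule ccontr)
    define w where "w = M *v v"
    assume "M *v v \<noteq> 0"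
    then have w: "0 < w \<bullet> w" by (simp add: w_def)
    define r where "r = w \<bullet> (M *v w)"
    have r: "0 \<le> r" unfolding r_def by (rule nonneg)
    \<comment> \<open>A step against \<open>w\<close> small enough for the first-order decrease to
      beat the quadratic term; \<open>1 + r\<close> avoids dividing by zero when
      \<open>r = 0\<close>.\<close>
    define t where "t = (w \<bullet> w) / (1 + r)"
    have t: "0 < t" "t * (1 + r) = w \<bullet> w" using w r by (auto simp: t_def)
    have "0 \<le> (v - t *\<^sub>R w) \<bullet> (M *v (v - t *\<^sub>R w))" by (rule nonneg)
    also have "\<dots> = t * (t * r - 2 * (w \<bullet> w))"
      using symmetric_matrix_inner[OF sM, of v w] zero
      by (simp add: matrix_vector_mult_diff_distrib matrix_vector_mult_scaleR inner_diff_left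
          inner_diff_right r_def w_def[symmetric] algebra_simps)
    finally have "2 * (w \<bullet> w) \<le> t * r" using t(1) by (simp add: zero_le_mult_iff)
    then show False using t w by (simp add: algebra_simps)
  qed
  have ev: "eigenvalue A k"
    unfolding eigenvalue_def using Mv v1 by (intro exI[of _ v]) (auto simp: Mx)
  have "k' \<le> k" if "eigenvalue A k'" for k'
  proof -
    obtain x where x: "x \<noteq> 0" "A *v x = k' *\<^sub>R x" using \<open>eigenvalue A k'\<close> by (auto simp: eigenvalue_def)
    have "0 \<le> (k - k') * (x \<bullet> x)"
      using nonneg[of x] x(2) by (simp add: Mx inner_diff_right algebra_simps)
    moreover have "0 < x \<bullet> x" using x(1) by simp
    ultimately show ?thesis by (simp add: zero_le_mult_iff)
  qed
  with ev have "lambda_max A = k" unfolding lambda_max_def by (rule Greatest_equality)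
  then show "pos_semidef (mat (lambda_max A) - A)" "eigenvalue A (lambda_max A)"
    using ev nonneg sM by (auto simp: pos_semidef_def M_def)
qed

subsection \<open>Empirical distributions and mixtures\<close>

lemma nn_integral_empirical:
  assumes "f \<in> borel_measurable borel"
  shows "(\<integral>\<^sup>+x. f x \<partial>empirical N \<xi>) = ennreal (1 / real N) * (\<Sum>i=1..N. f (\<xi> i))"
  using assms unfolding empirical_def uniform_count_measure_def
  by (subst nn_integral_distr) (simp_all add: nn_integral_point_measure_finite sum_distrib_left)

lemma measurable_uniform_count_borel [simp, intro]:
  "(f :: nat \<Rightarrow> 'a::topological_space) \<in> borel_measurable (uniform_count_measure A)"
  by (simp add: uniform_count_measure_def)

lemma sets_empirical [simp, measurable_cong]: "sets (empirical N \<xi>) = sets borel"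
  by (simp add: empirical_def)

lemma prob_space_empirical: "1 \<le> N \<Longrightarrow> prob_space (empirical N \<xi>)"
  unfolding empirical_def
  by (intro prob_space.prob_space_distr prob_space_uniform_count_measure) auto

lemma AE_empirical:
  assumes "finite A" "\<And>i. i \<in> {1..N} \<Longrightarrow> \<xi> i \<in> A"
  shows "AE x in empirical N \<xi>. x \<in> A"
proof -
  have "{x \<in> space borel. x \<in> A} \<in> sets borel" using assms(1) by (simp add: finite_imp_closed)
  then show ?thesis
    unfolding empirical_def by (subst AE_distr_iff) (auto simp: assms(2) space_uniform_count_measure)
qed

lemma empirical_in_probs_on:
  assumes "1 \<le> N" "closed S" "\<And>i. i \<in> {1..N} \<Longrightarrow> \<xi> i \<in> S"
  shows "empirical N \<xi> \<in> probs_on S"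
proof -
  interpret prob_space "empirical N \<xi>" by (rule prob_space_empirical) fact
  have "AE x in empirical N \<xi>. x \<in> S"
    by (rule eventually_mono[OF AE_empirical[of "\<xi> ` {1..N}" N \<xi>]]) (use assms(3) in auto)
  then show ?thesis
    using assms by (auto simp: probs_on_def prob_space_axioms emeasure_eq_1_AE)
qed

text \<open>Removes the square root, so that all later estimates concern the squared cost; for
  infinite cost both sides fail.\<close>

lemma ambiguity_set_iff:
  assumes "0 \<le> \<epsilon>"
  shows "P' \<in> ambiguity_set S P \<epsilon> \<longleftrightarrow> P' \<in> probs_on S \<and> wasserstein2_sq P P' \<le> ennreal \<epsilon>"
proof (cases "wasserstein2_sq P P'" rule: ennreal_cases)
  case (real r)
  then show ?thesis using assms by (simp add: ambiguity_set_def wasserstein2_def)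
next
  case top
  then show ?thesis by (simp add: ambiguity_set_def wasserstein2_def top_unique)
qed

text \<open>The infimum is bounded by the coupling that pairs the two families index by
  index.\<close>

lemma wasserstein2_sq_empirical_le:
  assumes "1 \<le> N"
  shows "wasserstein2_sq (empirical N \<xi>) (empirical N \<zeta>)
    \<le> ennreal (1 / real N * (\<Sum>i=1..N. (norm (\<xi> i - \<zeta> i))\<^sup>2))"
proof -
  let ?U = "uniform_count_measure {1..N}"
  let ?\<pi> = "distr ?U (borel \<Otimes>\<^sub>M borel) (\<lambda>i. (\<xi> i, \<zeta> i))"
  have m: "(\<lambda>i. (\<xi> i, \<zeta> i)) \<in> ?U \<rightarrow>\<^sub>M borel \<Otimes>\<^sub>M borel" by (intro measurable_Pair) auto
  have "prob_space ?\<pi>"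
    using assms m by (intro prob_space.prob_space_distr prob_space_uniform_count_measure) auto
  moreover have "distr ?\<pi> borel fst = empirical N \<xi>" "distr ?\<pi> borel snd = empirical N \<zeta>"
    unfolding empirical_def using m by (simp_all add: distr_distr comp_def)
  ultimately have "?\<pi> \<in> couplings (empirical N \<xi>) (empirical N \<zeta>)"
    by (simp add: couplings_def)
  then have "wasserstein2_sq (empirical N \<xi>) (empirical N \<zeta>)
      \<le> (\<integral>\<^sup>+z. ennreal ((norm (fst z - snd z))\<^sup>2) \<partial>?\<pi>)"
    unfolding wasserstein2_sq_def by (rule INF_lower)
  also have "\<dots> = (\<integral>\<^sup>+i. ennreal ((norm (\<xi> i - \<zeta> i))\<^sup>2) \<partial>?U)"
    using m by (subst nn_integral_distr) auto
  also have "\<dots> = (\<Sum>i=1..N. ennreal (1 / real N) * ennreal ((norm (\<xi> i - \<zeta> i))\<^sup>2))"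
    unfolding uniform_count_measure_def
    by (subst nn_integral_point_measure_finite) simp_all
  also have "\<dots> = ennreal (1 / real N * (\<Sum>i=1..N. (norm (\<xi> i - \<zeta> i))\<^sup>2))"
    by (simp only: sum_distrib_left[symmetric], subst sum_ennreal, simp,
        subst ennreal_mult, simp_all add: sum_nonneg)
  finally show ?thesis .
qed

section \<open>Mixtures of two probability measures\<close>

lemma ennreal_convex_1: "0 \<le> t \<Longrightarrow> t \<le> 1 \<Longrightarrow> ennreal t + ennreal (1 - t) = 1"
  by (simp flip: ennreal_plus)

text \<open>The convex combination with weight \<open>t\<close> on \<open>M1\<close>, encoded as a
  Bernoulli choice of the measure so that the rules for \<open>bind\<close> give its integrals and
  push-forwards.\<close>

definition mix :: "real \<Rightarrow> 'a measure \<Rightarrow> 'a measure \<Rightarrow> 'a measure" where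
  "mix t M1 M2 = measure_pmf (bernoulli_pmf t) \<bind> (\<lambda>b. if b then M1 else M2)"

context
  fixes t :: real and K M1 M2 :: "'a measure"
  assumes t: "0 \<le> t" "t \<le> 1"
    and M1: "prob_space M1" "sets M1 = sets K" and M2: "prob_space M2" "sets M2 = sets K"
begin

lemma mix_kernel: "(\<lambda>b. if b then M1 else M2) \<in> measure_pmf p \<rightarrow>\<^sub>M subprob_algebra K"
  using M1 M2 by (auto simp: space_subprob_algebra prob_space_imp_subprob_space)

lemma sets_mix: "sets (mix t M1 M2) = sets K"
  unfolding mix_def by (rule sets_bind_measurable[OF mix_kernel]) simp

lemma nn_integral_mix:
  assumes "f \<in> borel_measurable K"
  shows "(\<integral>\<^sup>+x. f x \<partial>mix t M1 M2) = ennreal t * (\<integral>\<^sup>+x. f x \<partial>M1) + ennreal (1 - t) * (\<integral>\<^sup>+x. f x \<partial>M2)"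
  unfolding mix_def using t by (simp add: nn_integral_bind[OF assms mix_kernel] mult.commute)

lemma emeasure_mix:
  assumes "A \<in> sets K"
  shows "emeasure (mix t M1 M2) A = ennreal t * emeasure M1 A + ennreal (1 - t) * emeasure M2 A"
  unfolding mix_def using t assms
  by (subst emeasure_bind[OF _ mix_kernel]) (simp_all add: mult.commute)

lemma prob_space_mix: "prob_space (mix t M1 M2)"
  unfolding mix_def
  by (intro prob_space.prob_space_bind[OF _ _ mix_kernel] prob_space_measure_pmf)
     (auto simp: M1 M2)

end

lemma mix_self:
  assumes "0 \<le> t" "t \<le> 1" "prob_space M"
  shows "mix t M M = M"
proof (rule measure_eqI)
  show "sets (mix t M M) = sets M" using assms by (intro sets_mix) auto
  fix A assume "A \<in> sets (mix t M M)"
  then have "A \<in> sets M" using \<open>sets (mix t M M) = sets M\<close> by simp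
  then show "emeasure (mix t M M) A = emeasure M A"
    using assms emeasure_mix[of t M M M A]
    by (simp add: distrib_right[symmetric] ennreal_convex_1)
qed

lemma distr_mix:
  assumes "0 \<le> t" "t \<le> 1" "prob_space M1" "sets M1 = sets K" "prob_space M2" "sets M2 = sets K"
    and f: "f \<in> K \<rightarrow>\<^sub>M L"
  shows "distr (mix t M1 M2) L f = mix t (distr M1 L f) (distr M2 L f)"
proof -
  have "distr (mix t M1 M2) L f
      = measure_pmf (bernoulli_pmf t) \<bind> (\<lambda>b. distr (if b then M1 else M2) L f)"
    unfolding mix_def by (rule distr_bind[OF mix_kernel _ f]) (use assms in auto)
  also have "(\<lambda>b. distr (if b then M1 else M2) L f) = (\<lambda>b. if b then distr M1 L f else distr M2 L f)"
    by auto
  finally show ?thesis by (simp add: mix_def)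
qed

text \<open>The common first marginal survives because mixing \<open>P\<close> with itself gives
  \<open>P\<close>.\<close>

lemma mix_in_couplings:
  assumes t: "0 \<le> t" "t \<le> 1" and c1: "\<pi>1 \<in> couplings P P1" and c2: "\<pi>2 \<in> couplings P P2"
  shows "mix t \<pi>1 \<pi>2 \<in> couplings P (mix t P1 P2)"
proof -
  have p1: "prob_space \<pi>1" "sets \<pi>1 = sets (borel \<Otimes>\<^sub>M borel)" "distr \<pi>1 borel fst = P" "distr \<pi>1 borel snd = P1"
    using c1 by (auto simp: couplings_def)
  have p2: "prob_space \<pi>2" "sets \<pi>2 = sets (borel \<Otimes>\<^sub>M borel)" "distr \<pi>2 borel fst = P" "distr \<pi>2 borel snd = P2"
    using c2 by (auto simp: couplings_def)
  have "fst \<in> \<pi>1 \<rightarrow>\<^sub>M borel" using measurable_cong_sets[OF p1(2) refl] measurable_fst by blast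
  then have P: "prob_space P" unfolding p1(3)[symmetric] by (rule prob_space.prob_space_distr[OF p1(1)])
  have "distr (mix t \<pi>1 \<pi>2) borel fst = P"
    by (subst distr_mix[OF t p1(1,2) p2(1,2) measurable_fst]) (simp add: p1(3) p2(3) mix_self[OF t P])
  moreover have "distr (mix t \<pi>1 \<pi>2) borel snd = mix t P1 P2"
    by (subst distr_mix[OF t p1(1,2) p2(1,2) measurable_snd]) (simp add: p1(4) p2(4))
  ultimately show ?thesis
    using prob_space_mix[OF t p1(1,2) p2(1,2)] sets_mix[OF t p1(1,2) p2(1,2)]
    by (simp add: couplings_def)
qed

text \<open>Transport cost is linear in the coupling, so mixing nearly optimal couplings makes the
  squared distance convex in its second argument.\<close>

lemma mix_in_ambiguity_set:
  assumes t: "0 \<le> t" "t \<le> 1" and e: "0 \<le> e1" "0 \<le> e2" and S: "closed S"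
    and P1: "P1 \<in> ambiguity_set S P e1" and P2: "P2 \<in> ambiguity_set S P e2"
  shows "mix t P1 P2 \<in> ambiguity_set S P (t * e1 + (1 - t) * e2)"
proof -
  let ?c = "\<lambda>\<pi>. \<integral>\<^sup>+z. ennreal ((norm (fst z - snd z))\<^sup>2) \<partial>\<pi>"
  have p1: "prob_space P1" "sets P1 = sets borel" "emeasure P1 S = 1" "wasserstein2_sq P P1 \<le> ennreal e1"
    and p2: "prob_space P2" "sets P2 = sets borel" "emeasure P2 S = 1" "wasserstein2_sq P P2 \<le> ennreal e2"
    using P1 P2 e by (auto simp: ambiguity_set_iff probs_on_def)
  have "mix t P1 P2 \<in> probs_on S"
    using prob_space_mix[OF t p1(1,2) p2(1,2)] sets_mix[OF t p1(1,2) p2(1,2)]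
      emeasure_mix[OF t p1(1,2) p2(1,2), of S] ennreal_convex_1[OF t] S p1(3) p2(3)
    by (simp add: probs_on_def)
  moreover have "wasserstein2_sq P (mix t P1 P2) \<le> ennreal (t * e1 + (1 - t) * e2)"
  proof (rule ennreal_le_epsilon)
    fix r :: real assume r: "0 < r"
    have "wasserstein2_sq P P1 < ennreal (e1 + r)" "wasserstein2_sq P P2 < ennreal (e2 + r)"
      using p1(4) p2(4) r e ennreal_less_iff[of e1 "e1 + r"] ennreal_less_iff[of e2 "e2 + r"]
      by (simp_all add: order.strict_trans1)
    then obtain \<pi>1 \<pi>2 where c: "\<pi>1 \<in> couplings P P1" "\<pi>2 \<in> couplings P P2"
      and l: "?c \<pi>1 < ennreal (e1 + r)" "?c \<pi>2 < ennreal (e2 + r)"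
      unfolding wasserstein2_sq_def INF_less_iff by blast
    have "wasserstein2_sq P (mix t P1 P2) \<le> ?c (mix t \<pi>1 \<pi>2)"
      unfolding wasserstein2_sq_def by (rule INF_lower[OF mix_in_couplings[OF t c]])
    also have "\<dots> = ennreal t * ?c \<pi>1 + ennreal (1 - t) * ?c \<pi>2"
      using c by (intro nn_integral_mix[where K = "borel \<Otimes>\<^sub>M borel"] t) (simp_all add: couplings_def)
    also have "\<dots> \<le> ennreal t * ennreal (e1 + r) + ennreal (1 - t) * ennreal (e2 + r)"
      using l by (intro add_mono mult_left_mono) auto
    also have "\<dots> = ennreal (t * (e1 + r) + (1 - t) * (e2 + r))"
      using t e r by (subst ennreal_plus) (simp_all add: ennreal_mult)
    also have "t * (e1 + r) + (1 - t) * (e2 + r) = t * e1 + (1 - t) * e2 + r"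
      by (simp add: algebra_simps)
    also have "ennreal (t * e1 + (1 - t) * e2 + r) = ennreal (t * e1 + (1 - t) * e2) + ennreal r"
      using t e r by (subst ennreal_plus) auto
    finally show "wasserstein2_sq P (mix t P1 P2) \<le> ennreal (t * e1 + (1 - t) * e2) + ennreal r" .
  qed
  ultimately show ?thesis using t e by (simp add: ambiguity_set_iff)
qed

subsection \<open>The worst-case risk and its dual\<close>

lemma concave_on_three_points:
  fixes f :: "real \<Rightarrow> real"
  assumes "concave_on S f" "x \<in> S" "z \<in> S" "x < y" "y < z"
  shows "(z - y) * f x + (y - x) * f z \<le> (z - x) * f y"
proof -
  define t where "t = (y - x) / (z - x)"
  have t: "0 \<le> t" "t \<le> 1" "(z - x) * t = y - x" using assms by (auto simp: t_def field_simps)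
  have "(1 - t) * x + t * z = x + (z - x) * t" by (simp add: algebra_simps)
  then have "(1 - t) * f x + t * f z \<le> f y"
    using concave_onD[OF assms(1) t(1,2) assms(2,3)] t(3) by simp
  then have "(z - x) * ((1 - t) * f x + t * f z) \<le> (z - x) * f y"
    using assms by (intro mult_left_mono) auto
  moreover have "(z - x) * ((1 - t) * f x + t * f z) = (z - x - (z - x) * t) * f x + (z - x) * t * f z"
    by (simp add: algebra_simps)
  ultimately show ?thesis by (simp add: t(3))
qed

text \<open>Slopes to the right of \<open>e\<close> grow as the increment shrinks and are bounded by
  every slope to the left, so they converge to their supremum \<open>L\<close>. Lying between right
  and left slopes, \<open>L\<close> is a supergradient.\<close>

lemma concave_on_right_derivative:
  fixes f :: "real \<Rightarrow> real"
  assumes conc: "concave_on {0..} f" and e: "0 < e"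
  obtains L where "((\<lambda>d. (f (e + d) - f e) / d) \<longlongrightarrow> L) (at_right 0)"
    and "\<And>x. 0 \<le> x \<Longrightarrow> f x \<le> f e + L * (x - e)"
proof -
  define g where "g d = (f (e + d) - f e) / d" for d
  have anti: "g d2 \<le> g d1" if "0 < d1" "d1 < d2" for d1 d2
    using concave_on_three_points[OF conc, of e "e + d2" "e + d1"] that e
    by (simp add: g_def field_simps)
  have left: "g d \<le> (f e - f x) / (e - x)" if "0 < d" "0 \<le> x" "x < e" for d x
    using concave_on_three_points[OF conc, of x "e + d" e] that e
    by (simp add: g_def field_simps)
  define L where "L = (SUP d\<in>{0<..}. g d)"
  \<comment> \<open>The slope between 0 and \<open>e\<close> is a bound; here \<open>0 < e\<close>
    enters.\<close>
  have bdd: "bdd_above (g ` {0<..})" using left[of _ 0] e by (intro bdd_aboveI2) auto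
  have le_L: "g d \<le> L" if "0 < d" for d unfolding L_def using that bdd by (intro cSUP_upper) auto
  have "(g \<longlongrightarrow> L) (at_right 0)"
  proof (rule order_tendstoI)
    fix a assume "a < L"
    then obtain d where d: "0 < d" "a < g d" unfolding L_def using bdd by (auto simp: less_cSUP_iff)
    then have "a < g r" if "r \<in> {0<..<d}" for r using anti[of r d] that by auto
    then show "\<forall>\<^sub>F r in at_right 0. a < g r" using d(1) by (auto simp: eventually_at_right)
  next
    fix a assume "L < a"
    have "\<forall>\<^sub>F r in at_right (0::real). 0 < r" by (simp add: eventually_at_right_less)
    then show "\<forall>\<^sub>F r in at_right 0. g r < a"
      by eventually_elim (use le_L \<open>L < a\<close> in force)
  qed
  moreover have "f x \<le> f e + L * (x - e)" if "0 \<le> x" for x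
  proof (cases x e rule: linorder_cases)
    case less
    have "L \<le> (f e - f x) / (e - x)"
      unfolding L_def by (intro cSUP_least) (use left less that in auto)
    then show ?thesis using less by (simp add: field_simps)
  next
    case greater
    then show ?thesis using le_L[of "x - e"] by (simp add: g_def field_simps)
  qed simp
  ultimately show thesis using that unfolding g_def by blast
qed

lemma continuous_on_quadratic [continuous_intros]:
  "continuous_on S (\<lambda>x. x \<bullet> ((Q :: real^'n^'n) *v x))"
  by (intro continuous_intros matrix_vector_mult_linear_continuous_on)

lemma continuous_on_penalized: "continuous_on S (penalized Q l a)"
  unfolding penalized_def[abs_def] by (intro continuous_intros)

section \<open>Concavity and duality of the risk over a compact support\<close>

locale empirical_risk =
  fixes S :: "(real^'d) set" and Q :: "real^'d^'d" and N :: nat and \<xi> :: "nat \<Rightarrow> real^'d"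
  assumes compact: "compact S" and N: "1 \<le> N" and sample: "\<And>i. i \<in> {1..N} \<Longrightarrow> \<xi> i \<in> S"
    and Q: "pos_semidef Q"
begin

abbreviation "risk \<equiv> worst_case_risk S (empirical N \<xi>) Q"
abbreviation "amb \<equiv> ambiguity_set S (empirical N \<xi>)"
abbreviation "expect P \<equiv> \<integral>x. x \<bullet> (Q *v x) \<partial>P"

lemma closed: "closed S" using compact by (rule compact_imp_closed)

lemma nonempty: "S \<noteq> {}" using sample[of 1] N by auto

lemma quadratic_nonneg: "0 \<le> x \<bullet> (Q *v x)" using Q by (simp add: pos_semidef_def)

lemma measurable_quadratic [measurable]: "(\<lambda>x. x \<bullet> (Q *v x)) \<in> borel_measurable borel"
  by (intro borel_measurable_continuous_onI continuous_intros)

lemma penalized_maximizer: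
  obtains x where "x \<in> S" "\<And>y. y \<in> S \<Longrightarrow> penalized Q l a y \<le> penalized Q l a x"
  using continuous_attains_sup[OF compact nonempty continuous_on_penalized] by blast

lemma quadratic_bounded: obtains B where "\<And>x. x \<in> S \<Longrightarrow> x \<bullet> (Q *v x) \<le> B"
  using penalized_maximizer[of 0 0] unfolding penalized_def by auto

lemma AE_probs_on: "P \<in> probs_on S \<Longrightarrow> AE x in P. x \<in> S"
  using closed by (subst prob_space.AE_in_set_eq_1) (auto simp: probs_on_def measure_def)

lemma integrable_quadratic:
  assumes "P \<in> probs_on S"
  shows "integrable P (\<lambda>x. x \<bullet> (Q *v x))"
proof -
  have P: "prob_space P" and [measurable_cong]: "sets P = sets borel"
    using assms by (auto simp: probs_on_def)
  interpret prob_space P by fact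
  obtain B where B: "\<And>x. x \<in> S \<Longrightarrow> x \<bullet> (Q *v x) \<le> B" using quadratic_bounded by blast
  show ?thesis
    by (rule integrable_const_bound[where B = B])
       (use AE_probs_on[OF assms] in \<open>auto elim!: eventually_mono simp: quadratic_nonneg B\<close>)
qed

text \<open>Passes to nonnegative integrals, in which mixtures and couplings are computed.\<close>

lemma nn_integral_quadratic:
  "P \<in> probs_on S \<Longrightarrow> (\<integral>\<^sup>+x. ennreal (x \<bullet> (Q *v x)) \<partial>P) = ennreal (expect P)"
  by (intro nn_integral_eq_integral integrable_quadratic) (simp_all add: quadratic_nonneg)

lemma expect_bounded: obtains B where "\<And>P. P \<in> probs_on S \<Longrightarrow> expect P \<le> B"
proof -
  obtain B where B: "\<And>x. x \<in> S \<Longrightarrow> x \<bullet> (Q *v x) \<le> B" using quadratic_bounded by blast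
  have "expect P \<le> B" if P: "P \<in> probs_on S" for P
  proof -
    interpret prob_space P using P by (simp add: probs_on_def)
    have "expect P \<le> (\<integral>x. B \<partial>P)"
      using AE_probs_on[OF P] B by (intro integral_mono_AE integrable_quadratic P) (auto elim!: eventually_mono)
    then show ?thesis by (simp add: prob_space)
  qed
  then show thesis using that by blast
qed

text \<open>The real supremum in \<open>worst_case_risk\<close> is meaningful only for a bounded
  family; compactness of \<open>S\<close> supplies the bound.\<close>

lemma bdd_above_expect: "bdd_above (expect ` amb \<epsilon>)"
  using expect_bounded by (metis (no_types, lifting) ambiguity_set_def bdd_aboveI2 mem_Collect_eq)

lemma expect_le_risk: "P \<in> amb \<epsilon> \<Longrightarrow> expect P \<le> risk \<epsilon>"
  unfolding worst_case_risk_def by (intro cSUP_upper bdd_above_expect)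

lemma empirical_in_amb:
  assumes "\<And>i. i \<in> {1..N} \<Longrightarrow> \<zeta> i \<in> S" "1 / real N * (\<Sum>i=1..N. (norm (\<xi> i - \<zeta> i))\<^sup>2) \<le> \<epsilon>"
  shows "empirical N \<zeta> \<in> amb \<epsilon>"
proof -
  have "0 \<le> 1 / real N * (\<Sum>i=1..N. (norm (\<xi> i - \<zeta> i))\<^sup>2)" by (simp add: sum_nonneg)
  then have "0 \<le> \<epsilon>" using assms(2) by linarith
  then show ?thesis
    using empirical_in_probs_on[OF N closed assms(1)] wasserstein2_sq_empirical_le[OF N, of \<xi> \<zeta>] assms(2)
    by (auto simp: ambiguity_set_iff intro: order_trans ennreal_leI)
qed

lemma amb_nonempty: "0 \<le> \<epsilon> \<Longrightarrow> amb \<epsilon> \<noteq> {}"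
  using empirical_in_amb[of \<xi> \<epsilon>] sample by auto

lemma expect_empirical: "expect (empirical N \<zeta>) = 1 / real N * (\<Sum>i=1..N. \<zeta> i \<bullet> (Q *v \<zeta> i))"
  unfolding empirical_def by (subst integral_distr) (simp_all add: integral_uniform_count_measure)

lemma expect_mix:
  assumes t: "0 \<le> t" "t \<le> 1" and P: "P1 \<in> probs_on S" "P2 \<in> probs_on S" "mix t P1 P2 \<in> probs_on S"
  shows "expect (mix t P1 P2) = t * expect P1 + (1 - t) * expect P2"
proof -
  have nonneg: "0 \<le> expect P" for P by (simp add: quadratic_nonneg)
  have "ennreal (expect (mix t P1 P2)) = ennreal t * ennreal (expect P1) + ennreal (1 - t) * ennreal (expect P2)"
    unfolding nn_integral_quadratic[OF P(1), symmetric] nn_integral_quadratic[OF P(2), symmetric]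
      nn_integral_quadratic[OF P(3), symmetric]
    using P by (intro nn_integral_mix[where K = borel] t) (auto simp: probs_on_def)
  also have "\<dots> = ennreal (t * expect P1 + (1 - t) * expect P2)"
    using t nonneg by (subst ennreal_plus) (simp_all add: ennreal_mult)
  finally show ?thesis using t nonneg by (subst (asm) ennreal_inj) simp_all
qed

text \<open>Distributions optimal up to \<open>r\<close> at the two radii are mixed: the expectation
  is linear, and the mixture is admissible because \<open>\<epsilon>\<close> bounds the squared
  distance.\<close>

lemma concave_risk: "concave_on {0..} risk"
  unfolding concave_on_iff
proof (intro conjI ballI allI impI)
  fix e1 e2 u v :: real
  assume e: "e1 \<in> {0..}" "e2 \<in> {0..}" and u: "0 \<le> u" and v: "0 \<le> v" and uv: "u + v = 1"
  have v_eq: "v = 1 - u" and u1: "u \<le> 1" using uv v by auto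
  show "u * risk e1 + v * risk e2 \<le> risk (u *\<^sub>R e1 + v *\<^sub>R e2)"
  proof (rule field_le_epsilon)
    fix r :: real assume "0 < r"
    have "\<exists>P\<in>amb \<epsilon>. risk \<epsilon> - r < expect P" if "\<epsilon> \<in> {0..}" for \<epsilon>
      using less_cSUP_iff[OF amb_nonempty bdd_above_expect, of \<epsilon> "risk \<epsilon> - r"] \<open>0 < r\<close> that
      by (auto simp: worst_case_risk_def)
    then obtain P1 P2 where P: "P1 \<in> amb e1" "risk e1 - r < expect P1" "P2 \<in> amb e2" "risk e2 - r < expect P2"
      using e by meson
    have m: "mix u P1 P2 \<in> amb (u * e1 + v * e2)"
      unfolding v_eq using e by (intro mix_in_ambiguity_set u u1 P closed) auto
    have "u * (risk e1 - r) + v * (risk e2 - r) \<le> u * expect P1 + v * expect P2"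
      using P u v by (intro add_mono mult_left_mono) auto
    also have "\<dots> = expect (mix u P1 P2)"
      unfolding v_eq using P m by (intro expect_mix[symmetric] u u1) (auto simp: ambiguity_set_def)
    also have "\<dots> \<le> risk (u * e1 + v * e2)" using m by (rule expect_le_risk)
    also have "u * (risk e1 - r) + v * (risk e2 - r) = u * risk e1 + v * risk e2 - (u + v) * r"
      by (simp add: algebra_simps)
    finally show "u * risk e1 + v * risk e2 \<le> risk (u *\<^sub>R e1 + v *\<^sub>R e2) + r" by (simp add: uv)
  qed
qed simp

text \<open>Weak duality for the transport: pointwise, the objective at the target is at most
  \<open>l\<close> times the cost plus the penalized supremum at the source. Integrating against a
  coupling leaves only its cost and its empirical marginal.\<close>

lemma risk_le_dual:
  assumes l: "0 \<le> l" and e: "0 \<le> \<epsilon>"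
    and s: "\<And>i x. i \<in> {1..N} \<Longrightarrow> x \<in> S \<Longrightarrow> penalized Q l (\<xi> i) x \<le> s i"
  shows "risk \<epsilon> \<le> l * \<epsilon> + 1 / real N * (\<Sum>i=1..N. s i)"
proof -
  define F where "F a = (SUP x\<in>S. penalized Q l a x)" for a
  have "bdd_above (penalized Q l a ` S)" for a
    using penalized_maximizer[of l a] by (metis bdd_aboveI2)
  then have F_upper: "penalized Q l a x \<le> F a" if "x \<in> S" for a x
    unfolding F_def using that by (intro cSUP_upper)
  have F_le: "F (\<xi> i) \<le> s i" if "i \<in> {1..N}" for i
    unfolding F_def using s that nonempty by (intro cSUP_least)
  \<comment> \<open>Staying at \<open>a\<close> costs nothing and has nonnegative objective.\<close>
  have F_nonneg: "0 \<le> F a" if "a \<in> S" for a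
    using F_upper[OF that, of a] quadratic_nonneg[of a] by (simp add: penalized_def)
  have FN: "0 \<le> (\<Sum>i=1..N. F (\<xi> i))"
    by (intro sum_nonneg F_nonneg sample)
  \<comment> \<open>A finite combination of indicators, hence measurable, that agrees with
    \<open>F\<close> at the samples. The sum ranges over the set of sample points, so a repeated
    sample enters once.\<close>
  define G where "G a = (\<Sum>b\<in>\<xi> ` {1..N}. ennreal (F b) * indicator {b} a)" for a
  have [measurable]: "G \<in> borel_measurable borel" unfolding G_def[abs_def] by measurable
  have G: "G a = ennreal (F a)" if "a \<in> \<xi> ` {1..N}" for a
    unfolding G_def using that by (subst sum.remove[OF _ that]) (auto intro!: sum.neutral)
  have "(\<Sum>i=1..N. G (\<xi> i)) = (\<Sum>i=1..N. ennreal (F (\<xi> i)))"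
    by (intro sum.cong G) auto
  also have "\<dots> = ennreal (\<Sum>i=1..N. F (\<xi> i))"
    by (intro sum_ennreal F_nonneg sample)
  finally have GN: "(\<integral>\<^sup>+x. G x \<partial>empirical N \<xi>) = ennreal (1 / real N * (\<Sum>i=1..N. F (\<xi> i)))"
    using FN by (subst nn_integral_empirical, measurable) (subst ennreal_mult, simp_all)
  have "expect P \<le> l * \<epsilon> + 1 / real N * (\<Sum>i=1..N. s i)" if P: "P \<in> amb \<epsilon>" for P
  proof -
    have p: "P \<in> probs_on S" "wasserstein2_sq (empirical N \<xi>) P \<le> ennreal \<epsilon>"
      using P e by (auto simp: ambiguity_set_iff)
    have [measurable_cong]: "sets P = sets borel" using p by (simp add: probs_on_def)
    have approx: "expect P \<le> l * (\<epsilon> + r) + 1 / real N * (\<Sum>i=1..N. F (\<xi> i))" if "0 < r" for r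
    proof -
      let ?c = "\<lambda>\<pi>. \<integral>\<^sup>+z. ennreal ((norm (fst z - snd z))\<^sup>2) \<partial>\<pi>"
      have "wasserstein2_sq (empirical N \<xi>) P < ennreal (\<epsilon> + r)"
        using p(2) \<open>0 < r\<close> e ennreal_less_iff[of \<epsilon> "\<epsilon> + r"] by (simp add: order.strict_trans1)
      then obtain \<pi> where "\<pi> \<in> couplings (empirical N \<xi>) P" and c: "?c \<pi> < ennreal (\<epsilon> + r)"
        unfolding wasserstein2_sq_def INF_less_iff by blast
      then have [measurable_cong]: "sets \<pi> = sets (borel \<Otimes>\<^sub>M borel)"
        and d: "distr \<pi> borel fst = empirical N \<xi>" "distr \<pi> borel snd = P"
        by (auto simp: couplings_def)
      \<comment> \<open>The pointwise bound requires \<open>fst z\<close> to be a sample, where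
        \<open>G\<close> is \<open>F\<close>, and \<open>snd z\<close> to lie in
        \<open>S\<close>.\<close>
      have "AE a in distr \<pi> borel fst. a \<in> \<xi> ` {1..N}"
        unfolding d by (rule AE_empirical) auto
      then have ae1: "AE z in \<pi>. fst z \<in> \<xi> ` {1..N}"
        by (rule AE_distrD[rotated]) measurable
      have "AE a in distr \<pi> borel snd. a \<in> S"
        unfolding d by (rule AE_probs_on[OF p(1)])
      then have ae2: "AE z in \<pi>. snd z \<in> S"
        by (rule AE_distrD[rotated]) measurable
      have "ennreal (expect P) = (\<integral>\<^sup>+z. ennreal (snd z \<bullet> (Q *v snd z)) \<partial>\<pi>)"
        unfolding nn_integral_quadratic[OF p(1), symmetric] unfolding d(2)[symmetric]
        by (subst nn_integral_distr) measurable
      also have "\<dots> \<le> (\<integral>\<^sup>+z. ennreal l * ennreal ((norm (fst z - snd z))\<^sup>2) + G (fst z) \<partial>\<pi>)"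
      proof (rule nn_integral_mono_AE, use ae1 ae2 in eventually_elim)
        case (elim z)
        then have nn: "0 \<le> F (fst z)" using sample by (auto intro: F_nonneg)
        have "snd z \<bullet> (Q *v snd z) \<le> l * (norm (fst z - snd z))\<^sup>2 + F (fst z)"
          using F_upper[OF elim(2), of "fst z"] by (simp add: penalized_def)
        then have "ennreal (snd z \<bullet> (Q *v snd z)) \<le> ennreal (l * (norm (fst z - snd z))\<^sup>2 + F (fst z))"
          by (rule ennreal_leI)
        also have "\<dots> = ennreal l * ennreal ((norm (fst z - snd z))\<^sup>2) + G (fst z)"
          using l nn G[OF elim(1)] by (subst ennreal_plus) (simp_all add: ennreal_mult)
        finally show ?case .
      qed
      also have "\<dots> = ennreal l * ?c \<pi> + (\<integral>\<^sup>+z. G (fst z) \<partial>\<pi>)"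
        by (subst nn_integral_add, measurable, subst nn_integral_cmult, measurable)
      also have "(\<integral>\<^sup>+z. G (fst z) \<partial>\<pi>) = ennreal (1 / real N * (\<Sum>i=1..N. F (\<xi> i)))"
        unfolding GN[symmetric] d(1)[symmetric] by (subst nn_integral_distr) measurable
      also have "ennreal l * ?c \<pi> + \<dots> \<le> ennreal l * ennreal (\<epsilon> + r) + \<dots>"
        using c by (intro add_right_mono mult_left_mono) auto
      also have "\<dots> = ennreal (l * (\<epsilon> + r) + 1 / real N * (\<Sum>i=1..N. F (\<xi> i)))"
        using l e \<open>0 < r\<close> FN
        by (subst ennreal_plus[of "l * (\<epsilon> + r)"])
           (simp_all add: ennreal_mult del: ennreal_plus)
      finally show ?thesis
        using l e \<open>0 < r\<close> FN by (subst (asm) ennreal_le_iff) simp_all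
    qed
    have "expect P \<le> l * \<epsilon> + 1 / real N * (\<Sum>i=1..N. F (\<xi> i)) + r" if "0 < r" for r
    proof -
      \<comment> \<open>The slack is rescaled so that its product with \<open>l\<close> stays below
        \<open>r\<close>, also when \<open>l = 0\<close>.\<close>
      have "l * (r / (l + 1)) \<le> r" using l that by (simp add: field_simps)
      then have "l * (\<epsilon> + r / (l + 1)) \<le> l * \<epsilon> + r" by (simp add: distrib_left)
      moreover have "0 < r / (l + 1)" using l that by simp
      ultimately show ?thesis using approx[of "r / (l + 1)"] by linarith
    qed
    then have "expect P \<le> l * \<epsilon> + 1 / real N * (\<Sum>i=1..N. F (\<xi> i))"
      by (rule field_le_epsilon)
    also have "\<dots> \<le> l * \<epsilon> + 1 / real N * (\<Sum>i=1..N. s i)"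
      using F_le by (intro add_left_mono mult_left_mono sum_mono) auto
    finally show ?thesis .
  qed
  then show ?thesis
    unfolding worst_case_risk_def by (intro cSUP_least amb_nonempty e)
qed

text \<open>Push every sample to a maximizer for the multiplier \<open>l\<close>. The cost \<open>e\<close> of this transport need
  not be \<open>\<epsilon>\<close>, but the supporting line of the concave risk at \<open>\<epsilon>\<close> transfers the estimate from \<open>e\<close> to \<open>\<epsilon>\<close>.\<close>
lemma dual_le_risk:
  assumes e: "0 < \<epsilon>"
    and x: "\<And>i. i \<in> {1..N} \<Longrightarrow> x i \<in> S"
  defines "l \<equiv> shadow_cost S (empirical N \<xi>) Q \<epsilon>"
  shows "l * \<epsilon> + 1 / real N * (\<Sum>i=1..N. penalized Q l (\<xi> i) (x i)) \<le> risk \<epsilon>"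
proof -
  obtain L where L: "((\<lambda>d. (risk (\<epsilon> + d) - risk \<epsilon>) / d) \<longlongrightarrow> L) (at_right 0)"
    and sup: "\<And>e. 0 \<le> e \<Longrightarrow> risk e \<le> risk \<epsilon> + L * (e - \<epsilon>)"
    using concave_on_right_derivative[OF concave_risk e] by blast
  \<comment> \<open>\<open>Lim\<close> denotes the right derivative only because convergence has
    just been obtained.\<close>
  have l: "l = L" unfolding l_def shadow_cost_def using L by (intro tendsto_Lim) auto
  define e where "e = 1 / real N * (\<Sum>i=1..N. (norm (\<xi> i - x i))\<^sup>2)"
  have e0: "0 \<le> e" by (simp add: e_def sum_nonneg)
  have "expect (empirical N x) \<le> risk e"
    by (intro expect_le_risk empirical_in_amb x) (auto simp: e_def)
  also have "\<dots> \<le> risk \<epsilon> + l * (e - \<epsilon>)" unfolding l by (rule sup[OF e0])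
  finally have "expect (empirical N x) - l * e + l * \<epsilon> \<le> risk \<epsilon>" by (simp add: algebra_simps)
  moreover have "expect (empirical N x) - l * e = 1 / real N * (\<Sum>i=1..N. penalized Q l (\<xi> i) (x i))"
    unfolding expect_empirical e_def penalized_def
    by (simp add: sum_subtractf sum_distrib_left[symmetric] algebra_simps diff_divide_distrib)
  ultimately show ?thesis by linarith
qed

end

section \<open>Comparison of the semidefinite program with the risk\<close>

theorem lemma3:
  fixes H :: "real^'d^'m" and h :: "real^'m"
    and Q :: "real^'d^'d"
    and N :: nat and \<xi> :: "nat \<Rightarrow> real^'d"
    and \<epsilon> :: real
  assumes "bounded (polyhedron_of H h)" and "full_dimensional (polyhedron_of H h)"
    and "1 \<le> N" and "\<forall>i\<in>{1..N}. \<xi> i \<in> polyhedron_of H h"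
    and "0 < \<epsilon>"
    and "pos_def Q"
  shows "worst_case_risk (polyhedron_of H h) (empirical N \<xi>) Q \<epsilon> \<le> lmi_value H h Q N \<xi> \<epsilon> \<and>
    (lambda_max Q \<le> shadow_cost (polyhedron_of H h) (empirical N \<xi>) Q \<epsilon> \<longrightarrow>
       worst_case_risk (polyhedron_of H h) (empirical N \<xi>) Q \<epsilon> = lmi_value H h Q N \<xi> \<epsilon>)"
proof -
  let ?S = "polyhedron_of H h"
  let ?V = "{lam * \<epsilon> + (1 / real N) * (\<Sum>i=1..N. s i) | lam \<alpha> s \<mu> \<psi>. lmi_feasible H h Q N \<xi> lam \<alpha> s \<mu> \<psi>}"
  have sQ: "symmetric_matrix Q" using assms(6) by (simp add: pos_def_def)
  have psd: "pos_semidef Q"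
    using assms(6) by (auto simp: pos_def_def pos_semidef_def) (metis inner_zero_left less_le order_refl)
  interpret empirical_risk ?S Q N \<xi>
    using assms closed_polyhedron_of psd by unfold_locales (auto simp: compact_eq_bounded_closed)
  obtain v where v: "v \<noteq> 0" "Q *v v = lambda_max Q *\<^sub>R v"
    using rayleigh_max(2)[OF sQ] by (auto simp: eigenvalue_def)
  have "0 \<le> lambda_max Q * (v \<bullet> v)"
    using quadratic_nonneg[of v] by (simp add: v)
  then have lmax: "0 \<le> lambda_max Q"
    using v(1) by (metis inner_gt_zero_iff mult_neg_pos not_le)
  have upper: "risk \<epsilon> \<le> z" if V: "z \<in> ?V" for z
  proof -
    obtain l \<alpha> s \<mu> \<psi> where f: "lmi_feasible H h Q N \<xi> l \<alpha> s \<mu> \<psi>"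
      and z: "z = l * \<epsilon> + 1 / real N * (\<Sum>i=1..N. s i)"
      using V by blast
    have "penalized Q l (\<xi> i) x \<le> s i" if "i \<in> {1..N}" "x \<in> ?S" for i x
      using f that unfolding lmi_feasible_def
      by (intro penalized_le_of_pos_semidef[where \<psi> = "\<psi> i" and c = "transpose H *v \<mu> i" and H = H and h = h])
         (auto simp del: transpose_matrix_vector intro: order_trans)
    then show ?thesis
      unfolding z using f assms(5) by (intro risk_le_dual) (auto simp: lmi_feasible_def)
  qed
  \<comment> \<open>For such \<open>l\<close> the inner dual is exact: the penalized maxima
    themselves are feasible values of \<open>s\<close>.\<close>
  have attained: "\<exists>x. (\<forall>i\<in>{1..N}. x i \<in> ?S) \<and>
      l * \<epsilon> + 1 / real N * (\<Sum>i=1..N. penalized Q l (\<xi> i) (x i)) \<in> ?V"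
    if l: "lambda_max Q \<le> l" for l
  proof -
    have "(mat l - Q) *v x = (mat (lambda_max Q) - Q) *v x + (l - lambda_max Q) *\<^sub>R x" for x
      by (simp add: matrix_vector_mult_diff_rdistrib mat_mult algebra_simps)
    then have lQ: "pos_semidef (mat l - Q)"
      using rayleigh_max(1)[OF sQ] l sQ
      by (auto simp: pos_semidef_def inner_add_right symmetric_matrix_mat_diff)
    have "\<exists>x \<psi>. x \<in> ?S \<and> 0 \<le> \<psi> \<and> pos_semidef (sym_block3
             (mat (penalized Q l a x - h \<bullet> \<psi> + l * (norm a)\<^sup>2) :: real^1^1)
             (columnvector ((2 * l) *\<^sub>R a - transpose H *v \<psi>))
               (4 *\<^sub>R (mat l - Q))
             (columnvector (0 :: real^'d)) (0 :: real^'d^'d) (4 *\<^sub>R Q))" for a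
      by (metis penalized_maximizer[of l a] pos_semidef_of_maximizer[OF psd lQ, of _ H h a])
    then obtain x \<psi> where x: "\<And>a. x a \<in> ?S" "\<And>a. 0 \<le> \<psi> a" "\<And>a. pos_semidef (sym_block3
             (mat (penalized Q l a (x a) - h \<bullet> \<psi> a + l * (norm a)\<^sup>2) :: real^1^1)
             (columnvector ((2 * l) *\<^sub>R a - transpose H *v \<psi> a))
               (4 *\<^sub>R (mat l - Q))
             (columnvector (0 :: real^'d)) (0 :: real^'d^'d) (4 *\<^sub>R Q))"
      by metis
    \<comment> \<open>With \<open>\<alpha>\<close> and \<open>\<mu>\<close> zero, the second matrix
      inequality reduces to the semidefiniteness of \<open>mat l - Q\<close>.\<close>
    have "pos_semidef (sym_block2 (mat 0 :: real^1^1) (columnvector (0 :: real^'d)) (mat l - Q))"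
      using lQ unfolding pos_semidef_bordered2 by (simp add: pos_semidef_def)
    then have "lmi_feasible H h Q N \<xi> l 0 (\<lambda>i. penalized Q l (\<xi> i) (x (\<xi> i))) (\<lambda>_. 0) (\<lambda>i. \<psi> (\<xi> i))"
      using x lmax l by (auto simp: lmi_feasible_def simp del: transpose_matrix_vector)
    then show ?thesis using x(1) by (intro exI[of _ "\<lambda>i. x (\<xi> i)"]) blast
  qed
  \<comment> \<open>A real \<open>Inf\<close> inherits a lower bound only from a nonempty set;
    \<open>l = lambda_max Q\<close> provides a feasible point.\<close>
  have ne: "?V \<noteq> {}" using attained[OF order_refl] by blast
  have le: "risk \<epsilon> \<le> lmi_value H h Q N \<xi> \<epsilon>"
    unfolding lmi_value_def by (intro cInf_greatest ne upper)
  moreover have "lmi_value H h Q N \<xi> \<epsilon> \<le> risk \<epsilon>"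
    if l: "lambda_max Q \<le> shadow_cost ?S (empirical N \<xi>) Q \<epsilon>"
  proof -
    let ?l = "shadow_cost ?S (empirical N \<xi>) Q \<epsilon>"
    obtain x where x: "\<And>i. i \<in> {1..N} \<Longrightarrow> x i \<in> ?S"
      and V: "?l * \<epsilon> + 1 / real N * (\<Sum>i=1..N. penalized Q ?l (\<xi> i) (x i)) \<in> ?V"
      \<comment> \<open>The condition on the shadow cost makes it an admissible multiplier in the
        program.\<close>
      using attained[OF l] by blast
    have "lmi_value H h Q N \<xi> \<epsilon> \<le> ?l * \<epsilon> + 1 / real N * (\<Sum>i=1..N. penalized Q ?l (\<xi> i) (x i))"
      unfolding lmi_value_def by (intro cInf_lower V bdd_belowI[of _ "risk \<epsilon>"] upper)
    also have "\<dots> \<le> risk \<epsilon>" by (intro dual_le_risk assms(5) x)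
    finally show ?thesis .
  qed
  ultimately show ?thesis by (auto intro: antisym)
qed

end
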